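(* Let $P$ be an ergodic Markov kernel on a finite set $\mathcal X$, $n=|\mathcal X|\ge3$, reversible with respect to the strictly positive probability distribution $\pi$, and let $k\in\{2,\ldots,n-1\}$. Let $\eta_1\le\cdots\le\eta_{n-1}$ be the eigenvalues of $P^2$ on $\ell_0^2(\pi)$ with multiplicity and $\phi_1,\ldots,\phi_{n-1}$ the fixed corresponding $\pi$-orthonormal eigenbasis. Put $$L_{k-1}=\sum_{j=1}^{k-1}\eta_j,\qquad g=\eta_k-\eta_{k-1},\qquad W=\eta_{n-1}-\eta_1.$$ For every partition $\mathcal O$ of $\mathcal X$ into $k$ nonempty blocks, with $F(\mathcal O)=\|G_{\mathcal O}P-\Pi\|_{F,\pi}^2$ and $\delta(\mathcal O)=\sum_{j=1}^{k-1}\|(I-G_{\mathcal O})\phi_j\|_\pi^2$, $$L_{k-1}+g\,\delta(\mathcal O)\le F(\mathcal O)\le L_{k-1}+W\,\delta(\mathcal O).$$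
   Context: $\pi(x)>0$ for all $x\in\mathcal X$. $\ell^2(\pi)$ is the space of real functions on $\mathcal X$ with $\langle f,g\rangle_\pi=\sum_x\pi(x)f(x)g(x)$ and norm $\|\cdot\|_\pi$; $\ell^2_0(\pi)=\{f:\sum_x\pi(x)f(x)=0\}$. Kernels act by $(Pf)(x)=\sum_yP(x,y)f(y)$. Ergodic means irreducible and aperiodic; reversible means $\pi(x)P(x,y)=\pi(y)P(y,x)$ for all $x,y$. The eigenbasis $\phi_1,\ldots,\phi_{n-1}$ of $\ell_0^2(\pi)$ satisfies $P^2\phi_j=\eta_j\phi_j$ and is chosen so that each $\phi_j$ is also an eigenfunction of $P$. $\Pi(x,y)=\pi(y)$. The Gibbs kernel of $\mathcal O=\{O_1,\ldots,O_k\}$ is $G_{\mathcal O}(x,y)=\sum_{i=1}^k\mathbf 1_{O_i}(x)\mathbf 1_{O_i}(y)\pi(y)/\pi(O_i)$. For an operator $A$ on $\ell^2(\pi)$, $\|A\|_{F,\pi}^2=\operatorname{Tr}(A^*A)=\sum_{x,y}\frac{\pi(x)}{\pi(y)}A(x,y)^2$. *)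

theory Defs
  imports "HOL-Analysis.Analysis" "HOL-Library.Disjoint_Sets"
begin

text \<open>
  The state space is the finite type \<open>'a\<close>, so \<open>n = CARD('a)\<close>. Functions on it are vectors
  \<open>real ^ 'a\<close> and kernels are matrices \<open>real ^ 'a ^ 'a\<close> with \<open>K(x,y) = K $ x $ y\<close>; the action
  \<open>(K f)(x) = (\<Sum>y. K(x,y) f(y))\<close> is the library's \<open>K *v f\<close> and composition is \<open>K ** K'\<close>.
\<close>

definition prob_distribution :: "real ^ 'a \<Rightarrow> bool" where
  "prob_distribution \<pi> \<longleftrightarrow> (\<forall>x. 0 \<le> \<pi> $ x) \<and> (\<Sum>x\<in>UNIV. \<pi> $ x) = 1"

definition markov_kernel :: "real ^ 'a ^ 'a \<Rightarrow> bool" where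
  "markov_kernel P \<longleftrightarrow> (\<forall>x y. 0 \<le> P $ x $ y) \<and> (\<forall>x. (\<Sum>y\<in>UNIV. P $ x $ y) = 1)"

text \<open>The operation \<open>^\<close> on \<open>real ^ 'a ^ 'a\<close> is the entrywise power, hence the separate definition.\<close>

definition kernel_power :: "real ^ 'a ^ 'a \<Rightarrow> nat \<Rightarrow> real ^ 'a ^ 'a" where
  "kernel_power P m = ((\<lambda>K. P ** K) ^^ m) (mat 1)"

definition irreducible_kernel :: "real ^ 'a ^ 'a \<Rightarrow> bool" where
  "irreducible_kernel P \<longleftrightarrow> (\<forall>x y. \<exists>m. 0 < kernel_power P m $ x $ y)"

definition aperiodic_kernel :: "real ^ 'a ^ 'a \<Rightarrow> bool" where
  "aperiodic_kernel P \<longleftrightarrow> (\<forall>x. Gcd {m::nat. 0 < m \<and> 0 < kernel_power P m $ x $ x} = 1)"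

definition ergodic_kernel :: "real ^ 'a ^ 'a \<Rightarrow> bool" where
  "ergodic_kernel P \<longleftrightarrow> irreducible_kernel P \<and> aperiodic_kernel P"

definition reversible_kernel :: "real ^ 'a \<Rightarrow> real ^ 'a ^ 'a \<Rightarrow> bool" where
  "reversible_kernel \<pi> P \<longleftrightarrow> (\<forall>x y. \<pi> $ x * P $ x $ y = \<pi> $ y * P $ y $ x)"

definition pi_inner :: "real ^ 'a \<Rightarrow> real ^ 'a \<Rightarrow> real ^ 'a \<Rightarrow> real" where
  "pi_inner \<pi> f h = (\<Sum>x\<in>UNIV. \<pi> $ x * f $ x * h $ x)"

definition pi_norm :: "real ^ 'a \<Rightarrow> real ^ 'a \<Rightarrow> real" where
  "pi_norm \<pi> f = sqrt (pi_inner \<pi> f f)"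

definition l2_0 :: "real ^ 'a \<Rightarrow> (real ^ 'a) set" where
  "l2_0 \<pi> = {f. (\<Sum>x\<in>UNIV. \<pi> $ x * f $ x) = 0}"

definition stationary_kernel :: "real ^ 'a \<Rightarrow> real ^ 'a ^ 'a" where
  "stationary_kernel \<pi> = (\<chi> x y. \<pi> $ y)"

definition gibbs_kernel :: "real ^ 'a \<Rightarrow> 'a set set \<Rightarrow> real ^ 'a ^ 'a" where
  "gibbs_kernel \<pi> \<O> =
     (\<chi> x y. \<Sum>B\<in>\<O>. indicator B x * indicator B y * \<pi> $ y / (\<Sum>z\<in>B. \<pi> $ z))"

definition pi_adjoint :: "real ^ 'a \<Rightarrow> real ^ 'a ^ 'a \<Rightarrow> real ^ 'a ^ 'a" where
  "pi_adjoint \<pi> A = (\<chi> x y. \<pi> $ y * A $ y $ x / \<pi> $ x)"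

definition frob_norm :: "real ^ 'a \<Rightarrow> real ^ 'a ^ 'a \<Rightarrow> real" where
  "frob_norm \<pi> A = sqrt (trace (pi_adjoint \<pi> A ** A))"

text \<open>
  \<open>\<phi> 1, \<dots>, \<phi> (n - 1)\<close> is a \<open>\<pi>\<close>-orthonormal basis of the mean-zero functions with
  \<open>P\<^sup>2 (\<phi> j) = \<eta> j \<cdot> \<phi> j\<close>, the \<open>\<eta> j\<close> are nondecreasing, and each \<open>\<phi> j\<close> is also an
  eigenfunction of \<open>P\<close>. Values at indices outside \<open>{1..n - 1}\<close> are irrelevant. That the \<open>\<eta> j\<close>
  list the eigenvalues of \<open>P\<^sup>2\<close> with multiplicity is the lemma \<open>ordered_eigenbasis_multiplicity\<close>.
\<close>

definition ordered_eigenbasis ::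
  "real ^ 'a \<Rightarrow> real ^ 'a ^ 'a \<Rightarrow> (nat \<Rightarrow> real) \<Rightarrow> (nat \<Rightarrow> real ^ 'a) \<Rightarrow> bool" where
  "ordered_eigenbasis \<pi> P \<eta> \<phi> \<longleftrightarrow>
     mono_on {1..CARD('a) - 1} \<eta> \<and>
     (\<forall>i\<in>{1..CARD('a) - 1}. \<forall>j\<in>{1..CARD('a) - 1}.
        pi_inner \<pi> (\<phi> i) (\<phi> j) = (if i = j then 1 else 0)) \<and>
     span (\<phi> ` {1..CARD('a) - 1}) = l2_0 \<pi> \<and>
     (\<forall>j\<in>{1..CARD('a) - 1}. (P ** P) *v \<phi> j = \<eta> j *\<^sub>R \<phi> j) \<and>
     (\<forall>j\<in>{1..CARD('a) - 1}. \<exists>\<beta>. P *v \<phi> j = \<beta> *\<^sub>R \<phi> j)"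

lemma pi_inner_adjoint:
  fixes \<pi> :: "real ^ 'a"
  assumes "\<And>x. 0 < \<pi> $ x"
  shows "pi_inner \<pi> (A *v f) h = pi_inner \<pi> f (pi_adjoint \<pi> A *v h)"
proof -
  have nz: "\<pi> $ x \<noteq> 0" for x using assms[of x] by simp
  have "pi_inner \<pi> f (pi_adjoint \<pi> A *v h) =
      (\<Sum>x\<in>UNIV. \<Sum>y\<in>UNIV. \<pi> $ y * A $ y $ x * f $ x * h $ y)"
    by (auto simp: pi_inner_def pi_adjoint_def matrix_vector_mult_def sum_distrib_left nz
        intro!: sum.cong)
  also have "\<dots> = (\<Sum>y\<in>UNIV. \<Sum>x\<in>UNIV. \<pi> $ y * A $ y $ x * f $ x * h $ y)"
    by (rule sum.swap)
  also have "\<dots> = pi_inner \<pi> (A *v f) h"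
    by (auto simp: pi_inner_def matrix_vector_mult_def sum_distrib_left sum_distrib_right
        algebra_simps intro!: sum.cong)
  finally show ?thesis ..
qed

lemma frob_norm_sq:
  fixes \<pi> :: "real ^ 'a"
  assumes "\<And>x. 0 < \<pi> $ x"
  shows "(frob_norm \<pi> A)\<^sup>2 = (\<Sum>x\<in>UNIV. \<Sum>y\<in>UNIV. \<pi> $ x / \<pi> $ y * (A $ x $ y)\<^sup>2)"
proof -
  have "trace (pi_adjoint \<pi> A ** A) =
      (\<Sum>y\<in>UNIV. \<Sum>x\<in>UNIV. \<pi> $ x / \<pi> $ y * (A $ x $ y)\<^sup>2)"
    by (auto simp: trace_def pi_adjoint_def matrix_matrix_mult_def power2_eq_square intro!: sum.cong)
  also have "\<dots> = (\<Sum>x\<in>UNIV. \<Sum>y\<in>UNIV. \<pi> $ x / \<pi> $ y * (A $ x $ y)\<^sup>2)"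
    by (rule sum.swap)
  finally have eq: "trace (pi_adjoint \<pi> A ** A) = \<dots>" .
  have "0 \<le> trace (pi_adjoint \<pi> A ** A)"
    unfolding eq using assms by (intro sum_nonneg mult_nonneg_nonneg) (auto simp: less_imp_le)
  then show ?thesis by (simp add: frob_norm_def eq)
qed

lemma pi_inner_sum_left:
  "pi_inner \<pi> (\<Sum>i\<in>I. c i *\<^sub>R f i) h = (\<Sum>i\<in>I. c i * pi_inner \<pi> (f i) h)"
  unfolding pi_inner_def
  by (subst sum_distrib_left, subst sum.swap)
    (auto simp: sum_distrib_left sum_distrib_right algebra_simps intro!: sum.cong)

lemma ordered_eigenbasis_multiplicity:
  fixes \<pi> :: "real ^ 'a"
  assumes "ordered_eigenbasis \<pi> P \<eta> \<phi>"
  shows "dim {f \<in> l2_0 \<pi>. (P ** P) *v f = c *\<^sub>R f} = card {j \<in> {1..CARD('a) - 1}. \<eta> j = c}"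
proof -
  define I where "I = {1..CARD('a) - 1}"
  define J where "J = {j \<in> I. \<eta> j = c}"
  let ?E = "{f \<in> l2_0 \<pi>. (P ** P) *v f = c *\<^sub>R f}"
  have fin: "finite I" "finite J" "J \<subseteq> I" by (auto simp: I_def J_def)
  have orth: "pi_inner \<pi> (\<phi> i) (\<phi> j) = (if i = j then 1 else 0)" if "i \<in> I" "j \<in> I" for i j
    using assms that unfolding ordered_eigenbasis_def I_def by blast
  have sp: "span (\<phi> ` I) = l2_0 \<pi>"
    and ev: "\<And>j. j \<in> I \<Longrightarrow> (P ** P) *v \<phi> j = \<eta> j *\<^sub>R \<phi> j"
    using assms unfolding ordered_eigenbasis_def I_def by blast+
  have inj: "inj_on \<phi> I"
    by (rule inj_onI) (metis orth zero_neq_one)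
  have coeff: "pi_inner \<pi> (\<Sum>i\<in>I. u i *\<^sub>R \<phi> i) (\<phi> j) = u j" if "j \<in> I" for u j
    using that fin by (simp add: pi_inner_sum_left orth sum.delta if_distrib cong: if_cong)
  have indep: "independent (\<phi> ` I)"
    unfolding independent_explicit
  proof (intro conjI allI impI ballI)
    fix u v assume z: "(\<Sum>v\<in>\<phi> ` I. u v *\<^sub>R v) = 0" and "v \<in> \<phi> ` I"
    then obtain j where j: "j \<in> I" "v = \<phi> j" by blast
    have "(\<Sum>i\<in>I. u (\<phi> i) *\<^sub>R \<phi> i) = 0" using z by (simp add: sum.reindex[OF inj])
    then have "u (\<phi> j) = pi_inner \<pi> 0 (\<phi> j)" using coeff[OF j(1), of "u \<circ> \<phi>"] by simp
    then show "u v = 0" using j by (simp add: pi_inner_def)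
  qed (simp add: fin)
  have "?E \<subseteq> span (\<phi> ` J)"
  proof
    fix f assume f: "f \<in> ?E"
    then have "f \<in> span (\<phi> ` I)" using sp by simp
    then obtain u where "f = (\<Sum>v\<in>\<phi> ` I. u v *\<^sub>R v)"
      using span_finite[of "\<phi> ` I"] fin by auto
    then obtain w where w: "f = (\<Sum>i\<in>I. w i *\<^sub>R \<phi> i)"
      using that by (simp add: sum.reindex[OF inj])
    have "(P ** P) *v f = (\<Sum>i\<in>I. (w i * \<eta> i) *\<^sub>R \<phi> i)"
      unfolding w by (simp add: linear_sum[OF matrix_vector_mul_linear]
          linear_scale[OF matrix_vector_mul_linear] ev)
    moreover have "(P ** P) *v f = (\<Sum>i\<in>I. (c * w i) *\<^sub>R \<phi> i)"
      using f by (simp add: w scaleR_right.sum)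
    ultimately have "w j * \<eta> j = c * w j" if "j \<in> I" for j
      using coeff[OF that, of "\<lambda>i. w i * \<eta> i"] coeff[OF that, of "\<lambda>i. c * w i"] by simp
    then have "w j = 0" if "j \<in> I - J" for j using that by (auto simp: J_def)
    then have "f = (\<Sum>i\<in>J. w i *\<^sub>R \<phi> i)"
      unfolding w using fin by (intro sum.mono_neutral_right) auto
    then show "f \<in> span (\<phi> ` J)"
      by (simp only:) (intro span_sum span_scale span_base imageI)
  qed
  moreover have "\<phi> ` J \<subseteq> ?E"
    using sp ev span_superset[of "\<phi> ` I"] by (auto simp: J_def)
  moreover have "independent (\<phi> ` J)"
    using indep fin(3) by (rule independent_mono[OF _ image_mono])
  moreover have "card (\<phi> ` J) = card J"
    using inj fin(3) by (intro card_image) (rule inj_on_subset)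
  ultimately have "dim ?E = card J" by (intro dim_unique) auto
  then show ?thesis by (simp add: J_def I_def)
qed

end

theory Submission
  imports Defs
begin

text \<open>
  The Gibbs kernel \<open>G\<close> is the \<open>\<pi>\<close>-orthogonal projection onto the functions that are constant on
  the blocks, so it has rank \<open>k\<close> and fixes the constants. Evaluating the Frobenius norm of
  \<open>G P - \<Pi>\<close> in the orthonormal basis \<open>1, \<phi>\<^sub>1, \<dots>, \<phi>\<^sub>n\<^sub>-\<^sub>1\<close> gives \<open>F = (\<Sum>j. \<eta>\<^sub>j a\<^sub>j)\<close> with
  \<open>a\<^sub>j = \<parallel>G \<phi>\<^sub>j\<parallel>\<^sup>2 \<in> [0, 1]\<close> and \<open>(\<Sum>j. a\<^sub>j) = k - 1\<close>. Hence \<open>\<delta>\<close> is both the mass \<open>1 - a\<^sub>j\<close> missing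
  from the indices \<open>j < k\<close> and the mass \<open>a\<^sub>j\<close> placed on the indices \<open>j \<ge> k\<close>; moving that mass
  changes \<open>(\<Sum>j. \<eta>\<^sub>j a\<^sub>j)\<close> by at least \<open>g \<delta>\<close> and at most \<open>W \<delta>\<close>.
\<close>

section \<open>Orthonormal expansions in the weighted space and the Frobenius norm\<close>

lemma pi_inner_diff_left: "pi_inner \<pi> (f - f') h = pi_inner \<pi> f h - pi_inner \<pi> f' h"
  by (simp add: pi_inner_def algebra_simps sum_subtractf)

lemma pi_inner_commute: "pi_inner \<pi> f h = pi_inner \<pi> h f"
  by (simp add: pi_inner_def mult.commute mult.left_commute)

lemma pi_inner_nonneg:
  assumes "\<And>x. 0 \<le> \<pi> $ x"
  shows "0 \<le> pi_inner \<pi> f f"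
  unfolding pi_inner_def using assms by (auto intro!: sum_nonneg simp: mult.assoc)

text \<open>Hypothesis \<open>complete\<close> is the resolution of the identity in coordinates: the
  matrix \<open>\<Sum>i\<in>I. e i $ x * e i $ y\<close> is the inverse of diag \<pi>. After the
  squares are expanded and the sum over \<open>i\<close> is moved innermost, it collapses the double
  sum over \<open>y\<close> and \<open>z\<close> to its diagonal.\<close>

lemma frob_norm_sq_basis:
  fixes \<pi> :: "real ^ 'a" and A :: "real ^ 'a ^ 'a" and e :: "'i \<Rightarrow> real ^ 'a"
  assumes pos: "\<And>x. 0 < \<pi> $ x"
    and complete: "\<And>x y. (\<Sum>i\<in>I. e i $ x * e i $ y) = (if x = y then 1 / \<pi> $ x else 0)"
  shows "(frob_norm \<pi> A)\<^sup>2 = (\<Sum>i\<in>I. pi_inner \<pi> (A *v e i) (A *v e i))"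
proof -
  have "(\<Sum>i\<in>I. pi_inner \<pi> (A *v e i) (A *v e i)) =
      (\<Sum>i\<in>I. \<Sum>x\<in>UNIV. \<Sum>y\<in>UNIV. \<Sum>z\<in>UNIV.
         \<pi> $ x * A $ x $ y * A $ x $ z * (e i $ y * e i $ z))"
    by (auto simp: pi_inner_def matrix_vector_mult_def sum_distrib_left sum_distrib_right
        algebra_simps intro!: sum.cong)
  also have "\<dots> = (\<Sum>x\<in>UNIV. \<Sum>i\<in>I. \<Sum>y\<in>UNIV. \<Sum>z\<in>UNIV.
         \<pi> $ x * A $ x $ y * A $ x $ z * (e i $ y * e i $ z))"
    by (rule sum.swap)
  also have "\<dots> = (\<Sum>x\<in>UNIV. \<Sum>y\<in>UNIV. \<Sum>i\<in>I. \<Sum>z\<in>UNIV.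
         \<pi> $ x * A $ x $ y * A $ x $ z * (e i $ y * e i $ z))"
    by (intro sum.cong refl) (rule sum.swap)
  also have "\<dots> = (\<Sum>x\<in>UNIV. \<Sum>y\<in>UNIV. \<Sum>z\<in>UNIV. \<Sum>i\<in>I.
         \<pi> $ x * A $ x $ y * A $ x $ z * (e i $ y * e i $ z))"
    by (intro sum.cong refl) (rule sum.swap)
  also have "\<dots> = (\<Sum>x\<in>UNIV. \<Sum>y\<in>UNIV. \<Sum>z\<in>UNIV.
         \<pi> $ x * A $ x $ y * A $ x $ z * (if y = z then 1 / \<pi> $ y else 0))"
    by (simp only: sum_distrib_left[symmetric] complete)
  also have "\<dots> = (\<Sum>x\<in>UNIV. \<Sum>y\<in>UNIV. \<pi> $ x / \<pi> $ y * (A $ x $ y)\<^sup>2)"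
    by (simp add: if_distrib power2_eq_square mult.assoc cong: if_cong)
  finally show ?thesis by (simp add: frob_norm_sq[OF pos])
qed

text \<open>The spanning hypothesis supplies some coefficients; pairing with each
  \<open>\<phi> j\<close> identifies them by orthonormality.\<close>

lemma l2_0_expansion:
  assumes "finite I"
    and orth: "\<And>i j. i \<in> I \<Longrightarrow> j \<in> I \<Longrightarrow> pi_inner \<pi> (\<phi> i) (\<phi> j) = (if i = j then 1 else 0)"
    and sp: "span (\<phi> ` I) = l2_0 \<pi>" and f: "f \<in> l2_0 \<pi>"
  shows "f = (\<Sum>i\<in>I. pi_inner \<pi> f (\<phi> i) *\<^sub>R \<phi> i)"
proof -
  have inj: "inj_on \<phi> I"
    by (rule inj_onI) (metis orth zero_neq_one)
  have "f \<in> span (\<phi> ` I)" using f sp by simp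
  then obtain u where "f = (\<Sum>v\<in>\<phi> ` I. u v *\<^sub>R v)"
    using span_finite[of "\<phi> ` I"] \<open>finite I\<close> by auto
  then have w: "f = (\<Sum>i\<in>I. u (\<phi> i) *\<^sub>R \<phi> i)"
    by (simp add: sum.reindex[OF inj])
  have "pi_inner \<pi> f (\<phi> j) = u (\<phi> j)" if "j \<in> I" for j
    using that \<open>finite I\<close>
    by (subst w) (simp add: pi_inner_sum_left orth if_distrib cong: if_cong)
  then show ?thesis by (subst w) simp
qed

text \<open>The leading 1 is the contribution of the constant function, the unit vector orthogonal
  to \<open>l2_0 \<pi>\<close>. This delivers the hypothesis \<open>complete\<close> above.\<close>

lemma l2_0_basis_complete:
  fixes \<pi> :: "real ^ 'a"
  assumes "prob_distribution \<pi>" and pos: "\<And>x. 0 < \<pi> $ x"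
    and "finite I"
    and orth: "\<And>i j. i \<in> I \<Longrightarrow> j \<in> I \<Longrightarrow> pi_inner \<pi> (\<phi> i) (\<phi> j) = (if i = j then 1 else 0)"
    and sp: "span (\<phi> ` I) = l2_0 \<pi>"
  shows "1 + (\<Sum>i\<in>I. \<phi> i $ x * \<phi> i $ y) = (if x = y then 1 / \<pi> $ x else 0)"
proof -
  have sum1: "(\<Sum>z\<in>UNIV. \<pi> $ z) = 1"
    using assms(1) by (simp add: prob_distribution_def)
  have nz: "\<pi> $ z \<noteq> 0" for z using pos[of z] by simp
  \<comment> \<open>The point mass at \<open>x\<close> divided by \<open>\<pi> $ x\<close>, with its
    mean 1 removed. It represents evaluation at \<open>x\<close> on mean-zero functions, so its
    coefficients are the values \<open>\<phi> i $ x\<close>.\<close>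
  define f :: "real ^ 'a" where "f = (\<chi> z. (if z = x then 1 / \<pi> $ x else 0) - 1)"
  have "f \<in> l2_0 \<pi>"
    by (simp add: l2_0_def f_def right_diff_distrib sum_subtractf sum1 nz
        if_distrib[of "\<lambda>u. \<pi> $ _ * u"] cong: if_cong)
  moreover have "pi_inner \<pi> f (\<phi> i) = \<phi> i $ x" if "i \<in> I" for i
  proof -
    have "\<phi> i \<in> l2_0 \<pi>" using sp that by (metis imageI span_base)
    then have "(\<Sum>z\<in>UNIV. \<pi> $ z * \<phi> i $ z) = 0" by (simp add: l2_0_def)
    moreover have "pi_inner \<pi> f (\<phi> i) =
        (\<Sum>z\<in>UNIV. (if z = x then \<phi> i $ z else 0) - \<pi> $ z * \<phi> i $ z)"
      unfolding pi_inner_def f_def by (intro sum.cong) (auto simp: nz algebra_simps)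
    ultimately show ?thesis by (simp add: sum_subtractf)
  qed
  ultimately have "(\<Sum>i\<in>I. pi_inner \<pi> f (\<phi> i) *\<^sub>R \<phi> i) = f"
    and inner: "\<And>i. i \<in> I \<Longrightarrow> pi_inner \<pi> f (\<phi> i) = \<phi> i $ x"
    using l2_0_expansion[OF \<open>finite I\<close> orth sp, of f] by auto
  then have "(\<Sum>i\<in>I. \<phi> i $ x *\<^sub>R \<phi> i) = f" by simp
  then have "f $ y = (\<Sum>i\<in>I. \<phi> i $ x * \<phi> i $ y)"
    by auto
  then show ?thesis by (auto simp: f_def)
qed

lemma frob_norm_sq_l2_0_basis:
  fixes \<pi> :: "real ^ 'a" and A :: "real ^ 'a ^ 'a" and \<phi> :: "'i \<Rightarrow> real ^ 'a"
  assumes "prob_distribution \<pi>" and pos: "\<And>x. 0 < \<pi> $ x"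
    and "finite I"
    and orth: "\<And>i j. i \<in> I \<Longrightarrow> j \<in> I \<Longrightarrow> pi_inner \<pi> (\<phi> i) (\<phi> j) = (if i = j then 1 else 0)"
    and sp: "span (\<phi> ` I) = l2_0 \<pi>"
  shows "(frob_norm \<pi> A)\<^sup>2 =
    pi_inner \<pi> (A *v 1) (A *v 1) + (\<Sum>i\<in>I. pi_inner \<pi> (A *v \<phi> i) (A *v \<phi> i))"
proof -
  \<comment> \<open>\<open>None\<close> indexes the constant function adjoined to the family; the
    option type provides a fresh index whatever the original index type is.\<close>
  define e where "e = (\<lambda>i. case i of None \<Rightarrow> 1 | Some j \<Rightarrow> \<phi> j)"
  have split: "(\<Sum>i\<in>insert None (Some ` I). h (e i)) = h 1 + (\<Sum>i\<in>I. h (\<phi> i))"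
    for h :: "real ^ 'a \<Rightarrow> real"
    using \<open>finite I\<close> by (simp add: e_def sum.reindex)
  have "(\<Sum>i\<in>insert None (Some ` I). e i $ x * e i $ y) = (if x = y then 1 / \<pi> $ x else 0)"
    for x y
    using split[of "\<lambda>v. v $ x * v $ y"] l2_0_basis_complete[OF assms, of x y] by simp
  from frob_norm_sq_basis[OF pos this, of A] show ?thesis
    using split[of "\<lambda>v. pi_inner \<pi> (A *v v) (A *v v)"] by simp
qed

section \<open>The Gibbs kernel as an orthogonal projection of rank \<open>card \<O>\<close>\<close>

lemma gibbs_kernel_block:
  assumes "partition_on UNIV \<O>" and "B \<in> \<O>" and "x \<in> B"
  shows "gibbs_kernel \<pi> \<O> $ x $ y = indicator B y * \<pi> $ y / (\<Sum>z\<in>B. \<pi> $ z)"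
proof -
  have uniq: "x \<in> C \<longleftrightarrow> C = B" if "C \<in> \<O>" for C
    using assms that by (metis disjointD disjoint_iff partition_onD2)
  have "(\<Sum>C\<in>\<O>. indicator C x * indicator C y * \<pi> $ y / (\<Sum>z\<in>C. \<pi> $ z)) =
      (\<Sum>C\<in>\<O>. if C = B then indicator B y * \<pi> $ y / (\<Sum>z\<in>B. \<pi> $ z) else 0)"
    by (intro sum.cong refl) (simp add: indicator_def uniq)
  then show ?thesis using assms(2) by (simp add: gibbs_kernel_def)
qed

text \<open>Each block's term in \<open>\<pi> $ x * gibbs_kernel \<pi> \<O> $ x $ y\<close> is
  symmetric in \<open>x\<close> and \<open>y\<close>.\<close>

lemma pi_adjoint_gibbs_kernel:
  assumes "\<And>x. \<pi> $ x \<noteq> 0"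
  shows "pi_adjoint \<pi> (gibbs_kernel \<pi> \<O>) = gibbs_kernel \<pi> \<O>"
  unfolding pi_adjoint_def gibbs_kernel_def
  by (auto simp: vec_eq_iff sum_distrib_left sum_divide_distrib assms intro!: sum.cong)

lemma block_mass_pos:
  fixes \<pi> :: "real ^ 'a"
  assumes "\<And>x. 0 < \<pi> $ x" and "partition_on UNIV \<O>" and "B \<in> \<O>"
  shows "0 < (\<Sum>z\<in>B. \<pi> $ z)"
  using assms by (intro sum_pos) (auto dest: partition_onD3)

text \<open>The kernel averages \<open>f\<close> over the block containing \<open>x\<close>, with
  weights that sum to 1. Both the fixing of constants and idempotence follow from this.\<close>

lemma gibbs_kernel_const_on_block:
  fixes \<pi> :: "real ^ 'a" and f :: "real ^ 'a"
  assumes pos: "\<And>x. 0 < \<pi> $ x" and part: "partition_on UNIV \<O>" and B: "B \<in> \<O>" "x \<in> B"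
    and const: "\<And>z. z \<in> B \<Longrightarrow> f $ z = c"
  shows "(gibbs_kernel \<pi> \<O> *v f) $ x = c"
proof -
  have "(gibbs_kernel \<pi> \<O> *v f) $ x = (\<Sum>y\<in>UNIV. indicator B y * (\<pi> $ y / (\<Sum>z\<in>B. \<pi> $ z) * f $ y))"
    by (auto simp: matrix_vector_mult_def gibbs_kernel_block[OF part B] intro!: sum.cong)
  also have "\<dots> = (\<Sum>y\<in>B. \<pi> $ y / (\<Sum>z\<in>B. \<pi> $ z) * f $ y)"
    by (rule sum.mono_neutral_cong_right) auto
  also have "\<dots> = (\<Sum>y\<in>B. \<pi> $ y / (\<Sum>z\<in>B. \<pi> $ z)) * c"
    by (simp add: const sum_distrib_right)
  also have "\<dots> = c"
    using block_mass_pos[OF pos part B(1)] by (simp add: sum_divide_distrib[symmetric])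
  finally show ?thesis .
qed

lemma gibbs_kernel_one:
  fixes \<pi> :: "real ^ 'a"
  assumes "\<And>x. 0 < \<pi> $ x" and "partition_on UNIV \<O>"
  shows "gibbs_kernel \<pi> \<O> *v 1 = 1"
proof -
  have "(gibbs_kernel \<pi> \<O> *v 1) $ x = 1" for x
  proof -
    obtain B where "B \<in> \<O>" "x \<in> B" using partition_onD1[OF assms(2)] by blast
    then show ?thesis by (intro gibbs_kernel_const_on_block[OF assms]) auto
  qed
  then show ?thesis by (simp add: vec_eq_iff)
qed

lemma gibbs_kernel_idem:
  fixes \<pi> :: "real ^ 'a"
  assumes "\<And>x. 0 < \<pi> $ x" and part: "partition_on UNIV \<O>"
  shows "gibbs_kernel \<pi> \<O> ** gibbs_kernel \<pi> \<O> = gibbs_kernel \<pi> \<O>"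
proof -
  let ?G = "gibbs_kernel \<pi> \<O>"
  have "(?G *v (?G *v f)) $ x = (?G *v f) $ x" for f :: "real ^ 'a" and x
  proof -
    obtain B where B: "B \<in> \<O>" "x \<in> B" using partition_onD1[OF part] by blast
    \<comment> \<open>The row of the kernel at \<open>z\<close> depends only on the block of
      \<open>z\<close>, so the once-averaged function is already constant on
      \<open>B\<close>.\<close>
    then show ?thesis
      by (intro gibbs_kernel_const_on_block[OF assms B])
        (simp add: matrix_vector_mult_def gibbs_kernel_block[OF part])
  qed
  then show ?thesis
    by (simp add: matrix_eq matrix_vector_mul_assoc[symmetric] vec_eq_iff)
qed

text \<open>The diagonal entries over one block are its conditional probabilities, so every block
  contributes 1.\<close>

lemma trace_gibbs_kernel:
  fixes \<pi> :: "real ^ 'a"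
  assumes "\<And>x. 0 < \<pi> $ x" and "partition_on UNIV \<O>"
  shows "trace (gibbs_kernel \<pi> \<O>) = card \<O>"
proof -
  have "trace (gibbs_kernel \<pi> \<O>) =
      (\<Sum>x\<in>UNIV. \<Sum>B\<in>\<O>. indicator B x * (\<pi> $ x / (\<Sum>z\<in>B. \<pi> $ z)))"
    by (auto simp: trace_def gibbs_kernel_def indicator_def intro!: sum.cong)
  also have "\<dots> = (\<Sum>B\<in>\<O>. \<Sum>x\<in>UNIV. indicator B x * (\<pi> $ x / (\<Sum>z\<in>B. \<pi> $ z)))"
    by (rule sum.swap)
  also have "\<dots> = (\<Sum>B\<in>\<O>. 1)"
  proof (rule sum.cong[OF refl])
    fix B assume "B \<in> \<O>"
    have "(\<Sum>x\<in>UNIV. indicator B x * (\<pi> $ x / (\<Sum>z\<in>B. \<pi> $ z))) =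
        (\<Sum>x\<in>B. \<pi> $ x / (\<Sum>z\<in>B. \<pi> $ z))"
      by (rule sum.mono_neutral_cong_right) auto
    then show "(\<Sum>x\<in>UNIV. indicator B x * (\<pi> $ x / (\<Sum>z\<in>B. \<pi> $ z))) = 1"
      using block_mass_pos[OF assms \<open>B \<in> \<O>\<close>] by (simp add: sum_divide_distrib[symmetric])
  qed
  finally show ?thesis by simp
qed

text \<open>For a self-adjoint idempotent the adjoint times the operator is the operator itself, so
  only its trace remains.\<close>

lemma frob_norm_gibbs_kernel_sq:
  fixes \<pi> :: "real ^ 'a"
  assumes pos: "\<And>x. 0 < \<pi> $ x" and part: "partition_on UNIV \<O>"
  shows "(frob_norm \<pi> (gibbs_kernel \<pi> \<O>))\<^sup>2 = card \<O>"
proof -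
  have "\<pi> $ x \<noteq> 0" for x using pos[of x] by simp
  then show ?thesis
    by (simp add: frob_norm_def pi_adjoint_gibbs_kernel gibbs_kernel_idem[OF pos part]
        trace_gibbs_kernel[OF pos part])
qed

text \<open>Self-adjointness moves one \<open>G\<close> across the inner product and idempotence
  absorbs it, which makes \<open>f - G *v f\<close> orthogonal to \<open>G *v f\<close>.\<close>

lemma gibbs_kernel_pythagoras:
  fixes \<pi> :: "real ^ 'a"
  assumes pos: "\<And>x. 0 < \<pi> $ x" and part: "partition_on UNIV \<O>"
  defines "G \<equiv> gibbs_kernel \<pi> \<O>"
  shows "(pi_norm \<pi> ((mat 1 - G) *v f))\<^sup>2 = pi_inner \<pi> f f - pi_inner \<pi> (G *v f) (G *v f)"
proof -
  have nz: "\<pi> $ x \<noteq> 0" for x using pos[of x] by simp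
  have "pi_inner \<pi> (G *v f) (G *v f) = pi_inner \<pi> f (G *v (G *v f))"
    unfolding G_def by (subst pi_inner_adjoint[OF pos]) (simp add: pi_adjoint_gibbs_kernel nz)
  also have "G *v (G *v f) = G *v f"
    by (simp add: G_def matrix_vector_mul_assoc gibbs_kernel_idem[OF pos part])
  finally have "pi_inner \<pi> (G *v f) (G *v f) = pi_inner \<pi> f (G *v f)" .
  moreover have "(mat 1 - G) *v f = f - G *v f"
    by (simp add: matrix_vector_mult_diff_rdistrib)
  moreover have "0 \<le> pi_inner \<pi> (f - G *v f) (f - G *v f)"
    using pos by (intro pi_inner_nonneg less_imp_le)
  ultimately show ?thesis
    by (simp add: pi_norm_def pi_inner_diff_left
        pi_inner_commute[of \<pi> _ "f - G *v f"] pi_inner_commute[of \<pi> "G *v f" f])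
qed

section \<open>Moving mass between the low and high ends of a sorted sequence\<close>

lemma weighted_sum_bounds:
  fixes \<eta> a :: "nat \<Rightarrow> real"
  assumes mono: "mono_on {1..m} \<eta>" and k: "2 \<le> k" "k \<le> m"
    and a: "\<And>j. j \<in> {1..m} \<Longrightarrow> 0 \<le> a j" "\<And>j. j \<in> {1..m} \<Longrightarrow> a j \<le> 1"
    and total: "(\<Sum>j = 1..m. a j) = real k - 1"
  defines "\<delta> \<equiv> (\<Sum>j = 1..k - 1. 1 - a j)"
  shows "(\<Sum>j = 1..k - 1. \<eta> j) + (\<eta> k - \<eta> (k - 1)) * \<delta> \<le> (\<Sum>j = 1..m. \<eta> j * a j)" (is ?lower)
    and "(\<Sum>j = 1..m. \<eta> j * a j) \<le> (\<Sum>j = 1..k - 1. \<eta> j) + (\<eta> m - \<eta> 1) * \<delta>" (is ?upper)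
proof -
  have split: "(\<Sum>j = 1..m. h j) = (\<Sum>j = 1..k - 1. h j) + (\<Sum>j = k..m. h j)"
    for h :: "nat \<Rightarrow> real"
    using k sum.ub_add_nat[of 1 "k - 1" h "m - (k - 1)"] by simp
  \<comment> \<open>The total mass \<open>k - 1\<close> equals the number of low indices, so the
    mass missing there sits at the indices from \<open>k\<close> on.\<close>
  have high: "(\<Sum>j = k..m. a j) = \<delta>"
    using total split[of a] k by (simp add: \<delta>_def sum_subtractf of_nat_diff)
  have low: "(\<Sum>j = 1..k - 1. \<eta> j * a j) =
      (\<Sum>j = 1..k - 1. \<eta> j) - (\<Sum>j = 1..k - 1. \<eta> j * (1 - a j))"
    by (simp add: sum_subtractf algebra_simps)
  have le: "\<eta> i \<le> \<eta> j" if "1 \<le> i" "i \<le> j" "j \<le> m" for i j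
    using mono_onD[OF mono, of i j] that by simp
  have "\<eta> k * \<delta> \<le> (\<Sum>j = k..m. \<eta> j * a j)" "(\<Sum>j = k..m. \<eta> j * a j) \<le> \<eta> m * \<delta>"
    unfolding high[symmetric] sum_distrib_left
    using k by (auto intro!: sum_mono mult_right_mono le a)
  moreover have "\<eta> 1 * \<delta> \<le> (\<Sum>j = 1..k - 1. \<eta> j * (1 - a j))"
    "(\<Sum>j = 1..k - 1. \<eta> j * (1 - a j)) \<le> \<eta> (k - 1) * \<delta>"
    unfolding \<delta>_def sum_distrib_left
    using k by (auto intro!: sum_mono mult_right_mono le a simp del: One_nat_def)
  \<comment> \<open>The weighted sum is the full low sum, minus the low deficit, plus the high part.
    The lower bound pairs \<open>\<eta> k\<close> with \<open>\<eta> (k - 1)\<close>, the upper one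
    \<open>\<eta> m\<close> with \<open>\<eta> 1\<close>.\<close>
  ultimately show ?lower ?upper
    unfolding split[of "\<lambda>j. \<eta> j * a j"] low by (simp_all add: left_diff_distrib)
qed

theorem theorem4p2:
  fixes \<pi> :: "real ^ 'a" and P :: "real ^ 'a ^ 'a"
    and \<eta> :: "nat \<Rightarrow> real" and \<phi> :: "nat \<Rightarrow> real ^ 'a"
    and k :: nat and \<O> :: "'a set set"
  assumes "3 \<le> CARD('a)"
    and "prob_distribution \<pi>" and "\<And>x. 0 < \<pi> $ x"
    and "markov_kernel P" and "ergodic_kernel P" and "reversible_kernel \<pi> P"
    and "ordered_eigenbasis \<pi> P \<eta> \<phi>"
    and "k \<in> {2..CARD('a) - 1}"
    and "partition_on UNIV \<O>" and "card \<O> = k"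
  defines "L \<equiv> (\<Sum>j = 1..k - 1. \<eta> j)"
    and "g \<equiv> \<eta> k - \<eta> (k - 1)"
    and "W \<equiv> \<eta> (CARD('a) - 1) - \<eta> 1"
    and "F \<equiv> (frob_norm \<pi> (gibbs_kernel \<pi> \<O> ** P - stationary_kernel \<pi>))\<^sup>2"
    and "\<delta> \<equiv> (\<Sum>j = 1..k - 1. (pi_norm \<pi> ((mat 1 - gibbs_kernel \<pi> \<O>) *v \<phi> j))\<^sup>2)"
  shows "L + g * \<delta> \<le> F \<and> F \<le> L + W * \<delta>"
proof -
  let ?I = "{1..CARD('a) - 1}"
  let ?G = "gibbs_kernel \<pi> \<O>"
  define a where "a j = pi_inner \<pi> (?G *v \<phi> j) (?G *v \<phi> j)" for j
  note pos = assms(3) and part = assms(9)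
  have mono: "mono_on ?I \<eta>"
    and orth: "\<And>i j. i \<in> ?I \<Longrightarrow> j \<in> ?I \<Longrightarrow> pi_inner \<pi> (\<phi> i) (\<phi> j) = (if i = j then 1 else 0)"
    and sp: "span (\<phi> ` ?I) = l2_0 \<pi>"
    and ev2: "\<And>j. j \<in> ?I \<Longrightarrow> (P ** P) *v \<phi> j = \<eta> j *\<^sub>R \<phi> j"
    and ev: "\<And>j. j \<in> ?I \<Longrightarrow> \<exists>\<beta>. P *v \<phi> j = \<beta> *\<^sub>R \<phi> j"
    using assms(7) unfolding ordered_eigenbasis_def by blast+
  note frob = frob_norm_sq_l2_0_basis[OF assms(2) pos finite_atLeastAtMost orth sp]
  have sum1: "(\<Sum>x\<in>UNIV. \<pi> $ x) = 1"
    using assms(2) by (simp add: prob_distribution_def)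
  have pyth: "(pi_norm \<pi> ((mat 1 - ?G) *v \<phi> j))\<^sup>2 = 1 - a j" if "j \<in> ?I" for j
    using gibbs_kernel_pythagoras[OF pos part, of "\<phi> j"] orth[OF that that] by (simp add: a_def)
  \<comment> \<open>Two evaluations of the squared Frobenius norm of \<open>?G\<close>: its trace,
    and the basis expansion, where the constant function accounts for the 1.\<close>
  have "real k = 1 + (\<Sum>j\<in>?I. a j)"
    using frob[of ?G] assms(10)
    by (simp add: frob_norm_gibbs_kernel_sq[OF pos part] gibbs_kernel_one[OF pos part] a_def
        pi_inner_def sum1)
  then have total: "(\<Sum>j = 1..CARD('a) - 1. a j) = real k - 1" by simp
  have a0: "0 \<le> a j" for j
    unfolding a_def using pos by (intro pi_inner_nonneg less_imp_le)
  have a1: "a j \<le> 1" if "j \<in> ?I" for j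
    using pyth[OF that] zero_le_power2[of "pi_norm \<pi> ((mat 1 - ?G) *v \<phi> j)"] by linarith
  let ?A = "?G ** P - stationary_kernel \<pi>"
  have "P *v 1 = 1"
    using assms(4) by (simp add: markov_kernel_def vec_eq_iff matrix_vector_mult_def)
  moreover have "stationary_kernel \<pi> *v 1 = 1"
    by (simp add: stationary_kernel_def vec_eq_iff matrix_vector_mult_def sum1)
  ultimately have A1: "?A *v 1 = 0"
    by (simp add: matrix_vector_mult_diff_rdistrib matrix_vector_mul_assoc[symmetric]
        gibbs_kernel_one[OF pos part])
  \<comment> \<open>The stationary kernel annihilates mean-zero functions and \<open>P\<close> acts
    on \<open>\<phi> j\<close> as a scalar \<open>\<beta>\<close>, so \<open>?A\<close> acts as
    \<open>\<beta>\<close> times \<open>?G\<close>; squaring gives the eigenvalue of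
    \<open>P ** P\<close>.\<close>
  have A\<phi>: "pi_inner \<pi> (?A *v \<phi> j) (?A *v \<phi> j) = \<eta> j * a j" if j: "j \<in> ?I" for j
  proof -
    obtain \<beta> where \<beta>: "P *v \<phi> j = \<beta> *\<^sub>R \<phi> j" using ev[OF j] by blast
    have "\<phi> j \<in> l2_0 \<pi>" using sp j by (metis imageI span_base)
    then have "stationary_kernel \<pi> *v \<phi> j = 0"
      by (simp add: stationary_kernel_def vec_eq_iff matrix_vector_mult_def l2_0_def)
    then have A: "?A *v \<phi> j = \<beta> *\<^sub>R (?G *v \<phi> j)"
      by (simp add: matrix_vector_mult_diff_rdistrib matrix_vector_mul_assoc[symmetric] \<beta>
          linear_scale[OF matrix_vector_mul_linear])
    have "\<phi> j \<noteq> 0" using orth[OF j j] by (auto simp: pi_inner_def)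
    moreover have "(\<beta> * \<beta>) *\<^sub>R \<phi> j = \<eta> j *\<^sub>R \<phi> j"
      using ev2[OF j]
      by (simp add: matrix_vector_mul_assoc[symmetric] \<beta> linear_scale[OF matrix_vector_mul_linear])
    ultimately have "\<beta> * \<beta> = \<eta> j" by simp
    then show ?thesis
      unfolding A a_def pi_inner_def
      by (simp add: sum_distrib_left mult.assoc mult.left_commute flip: \<open>\<beta> * \<beta> = \<eta> j\<close>)
  qed
  have F: "F = (\<Sum>j = 1..CARD('a) - 1. \<eta> j * a j)"
    using frob[of ?A] A\<phi> by (simp add: F_def A1 pi_inner_def[of \<pi> 0 0])
  have \<delta>: "\<delta> = (\<Sum>j = 1..k - 1. 1 - a j)"
    unfolding \<delta>_def using assms(8) by (intro sum.cong refl pyth) auto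
  have "2 \<le> k" "k \<le> CARD('a) - 1" using assms(8) by auto
  from weighted_sum_bounds[OF mono this a0 a1 total] show ?thesis
    unfolding F \<delta> L_def g_def W_def by blast
qed

end
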